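(* For each positive integer $n$, player ONE has a winning strategy in the game $\mathsf{GCDS}(\mathcal{G}_n,\mathsf{A}_n)$ if, and only if, $n$ is odd.
   Context: **The graphs $\mathcal{G}_n$ and sets $\mathsf{A}_n$.** $\mathcal{G}_1$ is the triangle with vertex set $\{1,2,3\}$ and edges $\{1,2\},\{1,3\},\{2,3\}$. Given $\mathcal{G}_n=(V_n,E_n)$ with $V_n=\{1,2,\dots,2n+1\}$, the graph $\mathcal{G}_{n+1}=(V_{n+1},E_{n+1})$ has $V_{n+1}=V_n\cup\{2n+2,2n+3\}$ and $E_{n+1}=E_n\cup\{\{2n+1,2n+2\},\{2n+1,2n+3\},\{2n+2,2n+3\}\}$. For each $n$, $\mathsf{A}_n=\{2\}\cup\{k\in V_n : k \bmod 4=0\}$. **The graph transformation gcds.** Let $\mathcal{G}=(V,E)$ be a graph and $\{x,y\}\in E$. The master list of $\{x,y\}$ has two columns: the first consists of all neighbors of $x$ in $\mathcal{G}$ except $y$, the second of all neighbors of $y$ in $\mathcal{G}$ except $x$. The graph $\mathbf{gcds}(\mathcal{G},\{x,y\})=(V,E')$ is defined as follows. Both $x$ and $y$ are isolated in it. For $p\ne q$ in $V\setminus\{x,y\}$: (a) if $p$ or $q$ is not in the master list, then $\{p,q\}\in E'$ iff $\{p,q\}\in E$; (b) if both are in the master list, then: (b.1) if no column contains both $p$ and $q$, then $\{p,q\}\in E'$ iff $\{p,q\}\notin E$; (b.2) if some column contains both and the total number of occurrences of $p$ and $q$ in the master list (both columns together) is even, then $\{p,q\}\in E'$ iff $\{p,q\}\in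 E$; (b.3) if some column contains both and that total number is odd, then $\{p,q\}\in E'$ iff $\{p,q\}\notin E$. **The modification $\mathbf{gcds}_2$.** For a finite graph $\mathcal{G}=(V,E)$ and $\{a,b\}\in E$, compute $(V,E')=\mathbf{gcds}(\mathcal{G},\{a,b\})$; then delete $a$ and $b$, and also delete every vertex $v$ in the master list of $\{a,b\}$ that is isolated in $(V,E')$, unless $v$ is the only vertex in the master list. With $V'$ the set of remaining vertices, $\mathbf{gcds}_2(\mathcal{G},\{a,b\})=(V',E')$. **The game.** For a finite graph $\mathcal{G}=(V,E)$ and $\mathsf{A}\subseteq V$, the game $\mathsf{GCDS}(\mathcal{G},\mathsf{A})$ starts with current graph $\mathcal{G}$. Players ONE and TWO alternate, ONE moving first; a move consists of choosing an edge $\{a,b\}$ of the current graph $\mathcal{C}$ and replacing $\mathcal{C}$ by $\mathbf{gcds}_2(\mathcal{C},\{a,b\})$. The game ends when the current graph has no edges. If the vertex set of the final graph is nonempty and is a subset of $\mathsf{A}$, then ONE wins; otherwise TWO wins. *)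

theory Defs
  imports Main
begin

text \<open>All graphs below are simple and undirected: an edge is a two-element set of vertices.\<close>

datatype 'a graph = Graph (verts: "'a set") (edges: "'a set set")

definition neighbors :: "'a graph \<Rightarrow> 'a \<Rightarrow> 'a set" where
  "neighbors G x = {w \<in> verts G. {x, w} \<in> edges G}"

definition isolated :: "'a graph \<Rightarrow> 'a \<Rightarrow> bool" where
  "isolated G v \<longleftrightarrow> neighbors G v = {}"

text \<open>
  The master list of an edge \<open>e = {x, y}\<close> has one column for each endpoint of \<open>e\<close>. As graphs are
  loopless, \<open>column G {x, y} x\<close> consists of the neighbors of \<open>x\<close> except \<open>y\<close>, and
  \<open>column G {x, y} y\<close> of the neighbors of \<open>y\<close> except \<open>x\<close>.
\<close>

definition column :: "'a graph \<Rightarrow> 'a set \<Rightarrow> 'a \<Rightarrow> 'a set" where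
  "column G e z = neighbors G z - e"

definition master_list :: "'a graph \<Rightarrow> 'a set \<Rightarrow> 'a set" where
  "master_list G e = (\<Union>z\<in>e. column G e z)"

definition occurrences :: "'a graph \<Rightarrow> 'a set \<Rightarrow> 'a \<Rightarrow> nat" where
  "occurrences G e p = card {z \<in> e. p \<in> column G e z}"

definition gcds_adj :: "'a graph \<Rightarrow> 'a set \<Rightarrow> 'a \<Rightarrow> 'a \<Rightarrow> bool" where
  "gcds_adj G e p q \<longleftrightarrow>
     (if p \<notin> master_list G e \<or> q \<notin> master_list G e then {p, q} \<in> edges G
      else if \<not> (\<exists>z\<in>e. p \<in> column G e z \<and> q \<in> column G e z) then {p, q} \<notin> edges G
      else if even (occurrences G e p + occurrences G e q) then {p, q} \<in> edges G
      else {p, q} \<notin> edges G)"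

definition gcds :: "'a graph \<Rightarrow> 'a set \<Rightarrow> 'a graph" where
  "gcds G e = Graph (verts G)
     {{p, q} | p q. p \<in> verts G - e \<and> q \<in> verts G - e \<and> p \<noteq> q \<and> gcds_adj G e p q}"

definition gcds2 :: "'a graph \<Rightarrow> 'a set \<Rightarrow> 'a graph" where
  "gcds2 G e = Graph
     (verts G - e - {v \<in> master_list G e. isolated (gcds G e) v \<and> master_list G e \<noteq> {v}})
     (edges (gcds G e))"


text \<open>
  A (partial) play is the list of edges chosen so far, in chronological order; ONE is to move after
  plays of even length, TWO after plays of odd length.
\<close>

fun play :: "'a graph \<Rightarrow> 'a set list \<Rightarrow> bool" where
  "play G [] \<longleftrightarrow> True"
| "play G (e # es) \<longleftrightarrow> e \<in> edges G \<and> play (gcds2 G e) es"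

definition position :: "'a graph \<Rightarrow> 'a set list \<Rightarrow> 'a graph" where
  "position G es = foldl gcds2 G es"

definition game_over :: "'a graph \<Rightarrow> bool" where
  "game_over G \<longleftrightarrow> edges G = {}"

definition ONE_wins_at :: "'a set \<Rightarrow> 'a graph \<Rightarrow> bool" where
  "ONE_wins_at A G \<longleftrightarrow> verts G \<noteq> {} \<and> verts G \<subseteq> A"

definition consistent_with :: "('a set list \<Rightarrow> 'a set) \<Rightarrow> 'a set list \<Rightarrow> bool" where
  "consistent_with \<sigma> es \<longleftrightarrow> (\<forall>i < length es. even i \<longrightarrow> es ! i = \<sigma> (take i es))"

text \<open>
  A winning strategy for ONE must prescribe a legal move whenever ONE is to move, and every finished
  play consistent with it must be won by ONE. There are no infinite plays to take care of: every move
  removes the two endpoints of the chosen edge from a finite graph.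
\<close>

definition winning_strategy_ONE ::
    "'a graph \<Rightarrow> 'a set \<Rightarrow> ('a set list \<Rightarrow> 'a set) \<Rightarrow> bool" where
  "winning_strategy_ONE G A \<sigma> \<longleftrightarrow>
     (\<forall>es. play G es \<and> consistent_with \<sigma> es \<longrightarrow>
        (if game_over (position G es) then ONE_wins_at A (position G es)
         else even (length es) \<longrightarrow> \<sigma> es \<in> edges (position G es)))"


text \<open>The family of graphs starts at index 1; the value at 0 is irrelevant.\<close>

fun tri_graph :: "nat \<Rightarrow> nat graph" where
  "tri_graph 0 = Graph {} {}"
| "tri_graph (Suc 0) = Graph {1, 2, 3} {{1, 2}, {1, 3}, {2, 3}}"
| "tri_graph (Suc (Suc m)) =
     (let n = Suc m; G = tri_graph n in
      Graph (verts G \<union> {2*n+2, 2*n+3})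
            (edges G \<union> {{2*n+1, 2*n+2}, {2*n+1, 2*n+3}, {2*n+2, 2*n+3}}))"

definition A_set :: "nat \<Rightarrow> nat set" where
  "A_set n = {2} \<union> {k \<in> verts (tri_graph n). k mod 4 = 0}"

end

theory Submission
  imports Defs
begin

text \<open>
  The graph \<open>tri_graph n\<close> is the line graph of a tree all of whose degrees are odd, and a move on
  the edge \<open>{x, y}\<close> contracts the tree edges \<open>x\<close> and \<open>y\<close>, merging the three nodes of the path they
  form. This yields a tree of the same kind, so that every move removes exactly two vertices, the
  game lasts \<open>n\<close> moves, and one vertex remains.

  For even \<open>n\<close>, TWO counts the vertices outside \<open>A\<close>: they are three quarters of all vertices (up to
  one), and if TWO always takes a vertex of \<open>A\<close>, then a move of each player costs at most three of
  them.

  For odd \<open>n\<close>, ONE counts the tree nodes that lie on an odd number of edges from \<open>A\<close>. Contraction adds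
  parities, so a move loses at most two odd nodes, and none if the contracted path contains at most
  one. Initially half of all nodes are odd. When exactly half of them are, the odd degrees force a
  path with at most one odd node, which ONE contracts; so there are always enough odd nodes, and
  the last edge, having two odd ends, belongs to \<open>A\<close>.
\<close>

section \<open>Strategies from invariants\<close>

lemma play_snoc: "play G (es @ [e]) \<longleftrightarrow> play G es \<and> e \<in> edges (position G es)"
  by (induction es arbitrary: G) (auto simp: position_def)

lemma position_snoc: "position G (es @ [e]) = gcds2 (position G es) e"
  by (simp add: position_def)

lemma consistent_with_snoc:
  "consistent_with \<sigma> (es @ [e]) \<longleftrightarrow>
     consistent_with \<sigma> es \<and> (even (length es) \<longrightarrow> e = \<sigma> es)"
  by (auto simp: consistent_with_def nth_append less_Suc_eq)

text \<open>\<open>P\<close> is meant for positions with ONE to move, \<open>Q\<close> for those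
  with TWO to move. ONE picks any edge leading into \<open>Q\<close>; by induction every consistent
  play then stays within the invariants.\<close>

lemma ONE_wins_by_invariant:
  assumes over: "\<And>G. P G \<or> Q G \<Longrightarrow> game_over G \<Longrightarrow> ONE_wins_at A G"
    and ONE: "\<And>G. P G \<Longrightarrow> \<not> game_over G \<Longrightarrow> \<exists>e\<in>edges G. Q (gcds2 G e)"
    and TWO: "\<And>G e. Q G \<Longrightarrow> e \<in> edges G \<Longrightarrow> P (gcds2 G e)"
    and init: "P G"
  shows "\<exists>\<sigma>. winning_strategy_ONE G A \<sigma>"
proof -
  define \<sigma> where
    "\<sigma> es = (SOME e. e \<in> edges (position G es) \<and> Q (gcds2 (position G es) e))" for es
  have \<sigma>: "\<sigma> es \<in> edges (position G es) \<and> Q (gcds2 (position G es) (\<sigma> es))"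
    if "P (position G es)" "\<not> game_over (position G es)" for es
    unfolding \<sigma>_def by (rule someI_ex) (use ONE[OF that] in blast)
  have inv: "if even (length es) then P (position G es) else Q (position G es)"
    if "play G es" "consistent_with \<sigma> es" for es
    using that
  proof (induction es rule: rev_induct)
    case Nil
    then show ?case using init by (simp add: position_def)
  next
    case (snoc e es)
    from snoc.prems have e: "e \<in> edges (position G es)" "even (length es) \<longrightarrow> e = \<sigma> es"
      and IH: "if even (length es) then P (position G es) else Q (position G es)"
      using snoc.IH by (auto simp: play_snoc consistent_with_snoc)
    show ?case
    proof (cases "even (length es)")
      case True
      moreover have "\<not> game_over (position G es)"
        using e(1) by (auto simp: game_over_def)
      ultimately show ?thesis using \<sigma>[of es] IH e by (simp add: position_snoc)
    next
      case False
      then show ?thesis using TWO[of "position G es" e] IH e by (simp add: position_snoc)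
    qed
  qed
  have "winning_strategy_ONE G A \<sigma>"
    unfolding winning_strategy_ONE_def
  proof (intro allI impI)
    fix es assume "play G es \<and> consistent_with \<sigma> es"
    with inv[of es] show "if game_over (position G es) then ONE_wins_at A (position G es)
       else even (length es) \<longrightarrow> \<sigma> es \<in> edges (position G es)"
      using over[of "position G es"] \<sigma>[of es] by (auto split: if_splits)
  qed
  then show ?thesis by blast
qed

text \<open>Against a winning \<open>\<sigma>\<close>, TWO can keep the play inside the invariants,
  where no final position is won by ONE. So the play could always be continued, which the shrinking
  vertex sets forbid.\<close>

lemma TWO_wins_by_invariant:
  assumes over: "\<And>G. P G \<or> Q G \<Longrightarrow> game_over G \<Longrightarrow> \<not> ONE_wins_at A G"
    and ONE: "\<And>G e. P G \<Longrightarrow> e \<in> edges G \<Longrightarrow> Q (gcds2 G e)"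
    and TWO: "\<And>G. Q G \<Longrightarrow> \<not> game_over G \<Longrightarrow> \<exists>e\<in>edges G. P (gcds2 G e)"
    and decr: "\<And>G e. P G \<or> Q G \<Longrightarrow> e \<in> edges G \<Longrightarrow> card (verts (gcds2 G e)) < card (verts G)"
    and init: "P G"
  shows "\<not> winning_strategy_ONE G A \<sigma>"
proof
  assume win: "winning_strategy_ONE G A \<sigma>"
  have False if "play G es" "consistent_with \<sigma> es"
    "if even (length es) then P (position G es) else Q (position G es)" for es
    using that
  proof (induction "card (verts (position G es))" arbitrary: es rule: less_induct)
    case less
    let ?H = "position G es"
    from less.prems have PQ: "P ?H \<or> Q ?H" by (auto split: if_splits)
    from win less.prems(1,2) have
      w: "if game_over ?H then ONE_wins_at A ?H else even (length es) \<longrightarrow> \<sigma> es \<in> edges ?H"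
      unfolding winning_strategy_ONE_def by blast
    with over[OF PQ] have no: "\<not> game_over ?H" by auto
    have "\<exists>e\<in>edges ?H. consistent_with \<sigma> (es @ [e]) \<and>
      (if even (length (es @ [e])) then P (gcds2 ?H e) else Q (gcds2 ?H e))"
    proof (cases "even (length es)")
      case True
      then show ?thesis
        using w no less.prems ONE[of ?H "\<sigma> es"] by (auto simp: consistent_with_snoc)
    next
      case False
      then show ?thesis
        using no less.prems TWO[of ?H] by (auto simp: consistent_with_snoc)
    qed
    then obtain e where "e \<in> edges ?H" "consistent_with \<sigma> (es @ [e])"
      "if even (length (es @ [e])) then P (gcds2 ?H e) else Q (gcds2 ?H e)" by blast
    then show False
      using less.hyps[of "es @ [e]"] less.prems(1) decr[OF PQ]
      by (simp add: play_snoc position_snoc cong: if_cong)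
  qed
  from this[of "[]"] init show False
    by (simp add: position_def consistent_with_def)
qed

section \<open>Line graphs of trees with odd degrees\<close>

text \<open>The elements of \<open>V\<close> name tree edges, with end nodes given by
  \<open>nd\<close>. A contraction then shrinks \<open>V\<close> and redirects \<open>nd\<close>,
  while the surviving game vertices keep their names.\<close>

definition line_graph :: "'a set \<Rightarrow> ('a \<Rightarrow> 'b set) \<Rightarrow> 'a graph" where
  "line_graph V nd =
     Graph V {{x, y} | x y. x \<in> V \<and> y \<in> V \<and> x \<noteq> y \<and> nd x \<inter> nd y \<noteq> {}}"

lemma verts_line_graph [simp]: "verts (line_graph V nd) = V"
  by (simp add: line_graph_def)

lemma edge_line_graph_iff [simp]:
  "{x, y} \<in> edges (line_graph V nd) \<longleftrightarrow> x \<in> V \<and> y \<in> V \<and> x \<noteq> y \<and> nd x \<inter> nd y \<noteq> {}"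
  by (auto simp: line_graph_def doubleton_eq_iff)

lemma edge_line_graphE:
  assumes "e \<in> edges (line_graph V nd)"
  obtains x y u where "e = {x, y}" "x \<in> V" "y \<in> V" "x \<noteq> y" "u \<in> nd x" "u \<in> nd y"
  using assms by (auto simp: line_graph_def)

text \<open>The boundary modulo 2 of \<open>B\<close>, read as a set of tree edges.\<close>

definition odd_nodes :: "'a set \<Rightarrow> 'b set \<Rightarrow> ('a \<Rightarrow> 'b set) \<Rightarrow> 'b set" where
  "odd_nodes B N nd = {r \<in> N. odd (card {z \<in> B. r \<in> nd z})}"

definition merge :: "'b set \<Rightarrow> 'b \<Rightarrow> 'b \<Rightarrow> 'b" where
  "merge M u r = (if r \<in> M then u else r)"

lemma card_2_mem:
  assumes "card S = 2" "a \<in> S"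
  obtains b where "S = {a, b}" "a \<noteq> b"
  using assms by (auto simp: card_2_iff)

lemma sum_card_incidence:
  assumes "finite M" "finite B"
  shows "(\<Sum>r\<in>M. card {z \<in> B. r \<in> nd z}) = (\<Sum>z\<in>B. card (nd z \<inter> M))"
proof -
  have "(\<Sum>r\<in>M. card {z \<in> B. r \<in> nd z}) = (\<Sum>r\<in>M. \<Sum>z\<in>B. if r \<in> nd z then 1 else 0)"
    by (simp only: card_eq_sum sum.inter_filter[OF assms(2)])
  also have "\<dots> = (\<Sum>z\<in>B. \<Sum>r\<in>M. if r \<in> nd z then 1 else 0)"
    by (rule sum.swap)
  also have "\<dots> = (\<Sum>z\<in>B. card {r \<in> M. r \<in> nd z})"
    by (simp only: card_eq_sum sum.inter_filter[OF assms(1)])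
  also have "\<dots> = (\<Sum>z\<in>B. card (nd z \<inter> M))"
    by (intro sum.cong arg_cong[where f = card]) auto
  finally show ?thesis .
qed

text \<open>
  The tree has the node set \<open>N\<close> and one edge for each element \<open>z\<close> of \<open>V\<close>, with the two endpoints
  \<open>nd z\<close>. Being a tree is expressed by the edge count and by sparsity of all induced subgraphs,
  as these two are visibly inherited by contractions.
\<close>

locale odd_tree =
  fixes V :: "'a set" and N :: "'b set" and nd :: "'a \<Rightarrow> 'b set"
  assumes finite_V: "finite V"
    and nd_subset: "z \<in> V \<Longrightarrow> nd z \<subseteq> N"
    and card_nd: "z \<in> V \<Longrightarrow> card (nd z) = 2"
    and card_N: "card N = Suc (card V)"
    and sparse: "W \<subseteq> N \<Longrightarrow> W \<noteq> {} \<Longrightarrow> card {z \<in> V. nd z \<subseteq> W} < card W"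
    and odd_degree: "r \<in> N \<Longrightarrow> odd (card {z \<in> V. r \<in> nd z})"
begin

lemma finite_N: "finite N"
  using card_N by (metis card.infinite nat.distinct(1))

lemma handshake: "B \<subseteq> V \<Longrightarrow> (\<Sum>r\<in>N. card {z \<in> B. r \<in> nd z}) = 2 * card B"
proof -
  assume B: "B \<subseteq> V"
  have "(\<Sum>r\<in>N. card {z \<in> B. r \<in> nd z}) = (\<Sum>z\<in>B. card (nd z \<inter> N))"
    using B finite_N finite_V by (intro sum_card_incidence) (auto intro: finite_subset)
  also have "\<dots> = (\<Sum>z\<in>B. 2)"
    using B nd_subset card_nd by (intro sum.cong) (auto simp: Int_absorb2)
  finally show ?thesis by simp
qed

lemma even_card_odd_nodes: "B \<subseteq> V \<Longrightarrow> even (card (odd_nodes B N nd))"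
  using even_sum_iff[OF finite_N, of "\<lambda>r. card {z \<in> B. r \<in> nd z}"] handshake[of B]
  by (simp add: odd_nodes_def)

text \<open>For \<open>B = V\<close> all nodes are odd, so the number of nodes is even, and it
  exceeds that of the edges by one.\<close>

lemma odd_card_V: "odd (card V)"
proof -
  have "odd_nodes V N nd = N" using odd_degree by (auto simp: odd_nodes_def)
  then show ?thesis using even_card_odd_nodes[of V] card_N by simp
qed

text \<open>This is the connectivity that the game needs. Otherwise each edge would lie in
  \<open>nd z\<close> or in its complement; by sparsity these hold at most one and at most
  \<open>card V - 2\<close> edges, one too few in total.\<close>

lemma nd_disjoint_not_all:
  assumes "z \<in> V" "card V \<noteq> 1"
  shows "\<exists>z'\<in>V. z' \<noteq> z \<and> nd z \<inter> nd z' \<noteq> {}"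
proof (rule ccontr)
  assume no: "\<not> ?thesis"
  let ?W = "N - nd z"
  have sub: "nd z \<subseteq> N" and two: "card (nd z) = 2"
    using assms(1) nd_subset card_nd by blast+
  have "card V \<ge> 2" using assms(2) odd_card_V by (cases "card V") auto
  have "card ?W = card N - card (nd z)"
    by (rule card_Diff_subset[OF finite_subset[OF sub finite_N] sub])
  then have W: "card ?W = card V - 1" using card_N two by simp
  then have "?W \<noteq> {}" using \<open>card V \<ge> 2\<close> by (metis card.empty diff_is_0_eq not_less_eq_eq
    numeral_2_eq_2 One_nat_def)
  then have "card {z' \<in> V. nd z' \<subseteq> ?W} < card V - 1"
    using sparse[of ?W] W by auto
  moreover have "nd z \<noteq> {}" using two by auto
  then have "card {z' \<in> V. nd z' \<subseteq> nd z} < 2"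
    using sparse[OF sub] two by simp
  moreover have "V \<subseteq> {z' \<in> V. nd z' \<subseteq> nd z} \<union> {z' \<in> V. nd z' \<subseteq> ?W}"
  proof
    fix p assume p: "p \<in> V"
    then have "p = z \<or> nd z \<inter> nd p = {}" using no by blast
    then show "p \<in> {z' \<in> V. nd z' \<subseteq> nd z} \<union> {z' \<in> V. nd z' \<subseteq> ?W}"
      using nd_subset[OF p] p by blast
  qed
  then have "card V \<le> card ({z' \<in> V. nd z' \<subseteq> nd z} \<union> {z' \<in> V. nd z' \<subseteq> ?W})"
    using finite_V by (intro card_mono) auto
  then have "card V \<le> card {z' \<in> V. nd z' \<subseteq> nd z} + card {z' \<in> V. nd z' \<subseteq> ?W}"
    by (rule order_trans[OF _ card_Un_le])
  ultimately show False by linarith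
qed

lemma game_over_iff: "game_over (line_graph V nd) \<longleftrightarrow> card V = 1"
proof
  assume over: "game_over (line_graph V nd)"
  from odd_card_V obtain z where "z \<in> V" by fastforce
  with over nd_disjoint_not_all[of z] show "card V = 1"
    by (metis edge_line_graph_iff empty_iff game_over_def)
next
  assume "card V = 1"
  then show "game_over (line_graph V nd)"
    by (auto simp: game_over_def line_graph_def card_1_singleton_iff)
qed

end

section \<open>Contracting a path of two tree edges\<close>

locale odd_tree_path = odd_tree V N nd for V :: "'a set" and N :: "'b set" and nd +
  fixes x y :: 'a and u :: 'b
  assumes x: "x \<in> V" and y: "y \<in> V" and xy: "x \<noteq> y" and ux: "u \<in> nd x" and uy: "u \<in> nd y"
begin

abbreviation M where "M \<equiv> nd x \<union> nd y"

lemma M_subset: "M \<subseteq> N"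
  using nd_subset x y by blast

lemma finite_M: "finite M"
  using M_subset finite_N finite_subset by blast

text \<open>If the outer ends agreed, \<open>x\<close> and \<open>y\<close> would be two edges on
  two nodes, against sparsity.\<close>

lemma path_nodes:
  obtains v w where "nd x = {u, v}" "nd y = {u, w}" "u \<noteq> v" "u \<noteq> w" "v \<noteq> w"
proof -
  obtain v where v: "nd x = {u, v}" "u \<noteq> v"
    by (rule card_2_mem[OF card_nd[OF x] ux])
  obtain w where w: "nd y = {u, w}" "u \<noteq> w"
    by (rule card_2_mem[OF card_nd[OF y] uy])
  note * = v(1) w(1) v(2) w(2)
  have "v \<noteq> w"
  proof
    assume "v = w"
    then have "{x, y} \<subseteq> {z \<in> V. nd z \<subseteq> {u, v}}" using * x y by auto
    then have "card {x, y} \<le> card {z \<in> V. nd z \<subseteq> {u, v}}"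
      using finite_V by (intro card_mono) auto
    then show False
      using sparse[of "{u, v}"] nd_subset[OF x] * xy by auto
  qed
  then show thesis by (rule that[OF *])
qed

lemma card_M: "card M = 3"
  by (rule path_nodes) (auto simp: card_insert_if)

lemma not_in_path: "p \<in> V \<Longrightarrow> p \<noteq> x \<Longrightarrow> p \<noteq> y \<Longrightarrow> \<not> nd p \<subseteq> M"
proof
  assume *: "p \<in> V" "p \<noteq> x" "p \<noteq> y" "nd p \<subseteq> M"
  then have "{x, y, p} \<subseteq> {z \<in> V. nd z \<subseteq> M}" using x y by auto
  then have "card {x, y, p} \<le> card {z \<in> V. nd z \<subseteq> M}"
    using finite_V by (intro card_mono) auto
  then show False
    using sparse[of M] M_subset ux card_M xy * by auto
qed

lemma meets_path:
  assumes "p \<in> V" "p \<noteq> x" "p \<noteq> y" "s \<in> nd p" "s \<in> M"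
  obtains r where "nd p = {s, r}" "r \<notin> M"
proof -
  obtain r where r: "nd p = {s, r}" by (rule card_2_mem[OF card_nd[OF assms(1)] assms(4)])
  moreover have "r \<notin> M" using r not_in_path[OF assms(1-3)] assms(5) by auto
  ultimately show thesis by (rule that)
qed

lemma card_meets_path:
  assumes "p \<in> V" "p \<noteq> x" "p \<noteq> y"
  shows "card (nd p \<inter> M) = (if nd p \<inter> M = {} then 0 else 1)"
proof (cases "nd p \<inter> M = {}")
  case False
  then obtain s where s: "s \<in> nd p" "s \<in> M" by blast
  then obtain r where "nd p = {s, r}" "r \<notin> M" by (rule meets_path[OF assms])
  then have "nd p \<inter> M = {s}" using s by auto
  then show ?thesis by simp
qed simp

text \<open>A common node \<open>r\<close> outside \<open>M\<close> would close a cycle: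
  \<open>x\<close>, \<open>y\<close>, \<open>p\<close>, \<open>q\<close> would be four edges on the
  four nodes of \<open>insert r M\<close>.\<close>

lemma no_bypass:
  assumes p: "p \<in> V" "p \<noteq> x" "p \<noteq> y" "nd p \<inter> M \<noteq> {}"
    and q: "q \<in> V" "q \<noteq> x" "q \<noteq> y" "nd q \<inter> M \<noteq> {}"
    and pq: "p \<noteq> q" "r \<in> nd p" "r \<in> nd q"
  shows "r \<in> M"
proof (rule ccontr)
  assume r: "r \<notin> M"
  have sub: "nd s \<subseteq> insert r M"
    if s: "s \<in> V" "s \<noteq> x" "s \<noteq> y" "nd s \<inter> M \<noteq> {}" "r \<in> nd s" for s
  proof -
    obtain t where t: "t \<in> nd s" "t \<in> M" using \<open>nd s \<inter> M \<noteq> {}\<close> by blast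
    then obtain r' where "nd s = {t, r'}" by (rule meets_path[OF s(1-3)])
    then show ?thesis using t r s by auto
  qed
  have "nd p \<subseteq> insert r M" "nd q \<subseteq> insert r M"
    using sub p q pq by simp_all
  then have "{x, y, p, q} \<subseteq> {z \<in> V. nd z \<subseteq> insert r M}" using x y p q by auto
  then have "card {x, y, p, q} \<le> card {z \<in> V. nd z \<subseteq> insert r M}"
    using finite_V by (intro card_mono) auto
  moreover have "card {x, y, p, q} = 4" using p q pq xy by simp
  moreover have "card (insert r M) = 4" using r card_M finite_M by simp
  moreover have "insert r M \<subseteq> N" using M_subset nd_subset[OF p(1)] pq by blast
  ultimately show False using sparse[of "insert r M"] by auto
qed

text \<open>The tree after the move: the path shrinks to its middle node \<open>u\<close>, the only
  node of \<open>M\<close> left in \<open>N'\<close>.\<close>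

abbreviation "V' \<equiv> V - {x, y}"
abbreviation "N' \<equiv> N - (M - {u})"
abbreviation "nd' \<equiv> \<lambda>z. merge M u ` nd z"

lemma mem_merge_image_iff:
  "r \<in> merge M u ` S \<longleftrightarrow> (if r = u then S \<inter> M \<noteq> {} else r \<in> S \<and> r \<notin> M)"
  using ux by (auto simp: merge_def image_iff split: if_splits)

lemma merge_meet_iff:
  "nd' p \<inter> nd' q \<noteq> {} \<longleftrightarrow>
    nd p \<inter> M \<noteq> {} \<and> nd q \<inter> M \<noteq> {} \<or> (\<exists>r. r \<notin> M \<and> r \<in> nd p \<and> r \<in> nd q)"
  unfolding ex_in_conv[symmetric] Int_iff mem_merge_image_iff using ux by auto

lemma column_path:
  "column (line_graph V nd) {x, y} x = {p \<in> V'. nd p \<inter> nd x \<noteq> {}}"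
  "column (line_graph V nd) {x, y} y = {p \<in> V'. nd p \<inter> nd y \<noteq> {}}"
  using x y by (auto simp: column_def neighbors_def)

lemma master_list_path: "master_list (line_graph V nd) {x, y} = {p \<in> V'. nd p \<inter> M \<noteq> {}}"
  by (auto simp: master_list_def column_path)

lemma occurrences_path:
  assumes "p \<in> V'"
  shows "occurrences (line_graph V nd) {x, y} p =
    (if nd p \<inter> nd x \<noteq> {} then 1 else 0) + (if nd p \<inter> nd y \<noteq> {} then 1 else 0)"
proof -
  have "{z \<in> {x, y}. p \<in> column (line_graph V nd) {x, y} z} =
    (if nd p \<inter> nd x \<noteq> {} then {x} else {}) \<union> (if nd p \<inter> nd y \<noteq> {} then {y} else {})"
    using assms by (auto simp: column_path)
  then show ?thesis using xy by (simp add: occurrences_def)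
qed

text \<open>The rules of \<open>gcds\<close> carry out the contraction, after which any two edges at
  the path are adjacent. With path \<open>v\<close>, \<open>u\<close>, \<open>w\<close>, an edge at
  \<open>u\<close> occurs twice in the master list and one at \<open>v\<close> or \<open>w\<close>
  once. Edges at the same node have an even total and stay adjacent. Edges at different nodes were
  not adjacent and become so: \<open>v\<close> with \<open>w\<close> for lack of a common column,
  \<open>u\<close> with \<open>v\<close> or \<open>w\<close> by the odd total 3.\<close>

lemma gcds_adj_path:
  assumes p: "p \<in> V'" and q: "q \<in> V'" and pq: "p \<noteq> q"
  shows "gcds_adj (line_graph V nd) {x, y} p q \<longleftrightarrow> nd' p \<inter> nd' q \<noteq> {}"
proof -
  obtain v w where vw: "nd x = {u, v}" "nd y = {u, w}" "u \<noteq> v" "u \<noteq> w" "v \<noteq> w"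
    by (rule path_nodes)
  have one: "\<not> (u \<in> nd s \<and> v \<in> nd s)" "\<not> (u \<in> nd s \<and> w \<in> nd s)" "\<not> (v \<in> nd s \<and> w \<in> nd s)"
    if "s \<in> V'" for s
  proof -
    have "card (nd s \<inter> M) \<le> 1" using card_meets_path[of s] that by auto
    then have *: "\<forall>a \<in> nd s \<inter> M. \<forall>b \<in> nd s \<inter> M. a = b"
      using card_le_Suc0_iff_eq[of "nd s \<inter> M"] finite_M by simp
    have eq: "a = b" if "a \<in> nd s" "b \<in> nd s" "a \<in> M" "b \<in> M" for a b
      using * that by blast
    show "\<not> (u \<in> nd s \<and> v \<in> nd s)" "\<not> (u \<in> nd s \<and> w \<in> nd s)" "\<not> (v \<in> nd s \<and> w \<in> nd s)"
      using eq[of u v] eq[of u w] eq[of v w] vw by auto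
  qed
  \<comment> \<open>\<open>D\<close> records a common node off the path, which two edges meeting the
    path cannot have.\<close>
  define D where "D \<longleftrightarrow> (\<exists>r. r \<notin> M \<and> r \<in> nd p \<and> r \<in> nd q)"
  have old: "nd p \<inter> nd q \<noteq> {} \<longleftrightarrow> u \<in> nd p \<and> u \<in> nd q \<or> v \<in> nd p \<and> v \<in> nd q \<or>
      w \<in> nd p \<and> w \<in> nd q \<or> D"
    using vw unfolding D_def by auto
  have meet: "nd s \<inter> nd x \<noteq> {} \<longleftrightarrow> u \<in> nd s \<or> v \<in> nd s"
    "nd s \<inter> nd y \<noteq> {} \<longleftrightarrow> u \<in> nd s \<or> w \<in> nd s"
    "nd s \<inter> M \<noteq> {} \<longleftrightarrow> u \<in> nd s \<or> v \<in> nd s \<or> w \<in> nd s" for s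
    using vw by auto
  have no_D: "\<not> D" if "nd p \<inter> M \<noteq> {}" "nd q \<inter> M \<noteq> {}"
    using no_bypass[of p q] p q pq that unfolding D_def by blast
  have "gcds_adj (line_graph V nd) {x, y} p q \<longleftrightarrow>
    (if \<not> (nd p \<inter> M \<noteq> {} \<and> nd q \<inter> M \<noteq> {}) then nd p \<inter> nd q \<noteq> {}
     else if \<not> (nd p \<inter> nd x \<noteq> {} \<and> nd q \<inter> nd x \<noteq> {} \<or> nd p \<inter> nd y \<noteq> {} \<and> nd q \<inter> nd y \<noteq> {})
       then \<not> nd p \<inter> nd q \<noteq> {}
     else if even (occurrences (line_graph V nd) {x, y} p + occurrences (line_graph V nd) {x, y} q)
       then nd p \<inter> nd q \<noteq> {} else \<not> nd p \<inter> nd q \<noteq> {})"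
    using p q pq
    by (simp add: gcds_adj_def master_list_path column_path)
  also have "\<dots> \<longleftrightarrow> nd p \<inter> M \<noteq> {} \<and> nd q \<inter> M \<noteq> {} \<or> D"
    unfolding occurrences_path[OF p] occurrences_path[OF q]
    unfolding meet old
    using one[OF p] one[OF q] no_D[unfolded meet]
    by (cases "u \<in> nd p"; cases "v \<in> nd p"; cases "w \<in> nd p"; cases "u \<in> nd q";
        cases "v \<in> nd q"; cases "w \<in> nd q"; cases D; simp)
  also have "\<dots> \<longleftrightarrow> nd' p \<inter> nd' q \<noteq> {}"
    unfolding D_def by (rule merge_meet_iff[symmetric])
  finally show ?thesis .
qed

lemma edges_gcds_path: "edges (gcds (line_graph V nd) {x, y}) = edges (line_graph V' nd')"
proof -
  have "p \<in> V' \<and> q \<in> V' \<and> p \<noteq> q \<and> gcds_adj (line_graph V nd) {x, y} p q \<longleftrightarrow>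
    p \<in> V' \<and> q \<in> V' \<and> p \<noteq> q \<and> nd' p \<inter> nd' q \<noteq> {}" for p q
    using gcds_adj_path[of p q] by blast
  then show ?thesis
    by (simp only: gcds_def line_graph_def[of V'] graph.sel verts_line_graph)
qed

text \<open>Modulo 2 the degree of the merged node is the sum of the degrees on the path, as
  \<open>x\<close> and \<open>y\<close> are counted twice there. Nodes off the path keep their
  incident edges.\<close>

lemma odd_nodes_contract:
  assumes B: "B \<subseteq> V"
  shows "odd_nodes (B - {x, y}) N' nd' =
    (odd_nodes B N nd - M) \<union> (if odd (card (odd_nodes B N nd \<inter> M)) then {u} else {})"
proof -
  have finB: "finite B" using B finite_V finite_subset by blast
  have away: "{z \<in> B - {x, y}. r \<in> nd' z} = {z \<in> B. r \<in> nd z}" if "r \<notin> M" for r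
    using that ux by (auto simp: mem_merge_image_iff)
  \<comment> \<open>Double counting turns the degree sum over \<open>M\<close> into a sum of
    \<open>card (nd z \<inter> M)\<close>, which is 2 for \<open>x\<close> and \<open>y\<close> and
    at most 1 for all other edges.\<close>
  have "even (card {z \<in> B. odd (card (nd z \<inter> M))}) \<longleftrightarrow> even (\<Sum>r\<in>M. card {z \<in> B. r \<in> nd z})"
    using even_sum_iff[OF finB, of "\<lambda>z. card (nd z \<inter> M)"] sum_card_incidence[OF finite_M finB]
    by simp
  also have "\<dots> \<longleftrightarrow> even (card {r \<in> M. odd (card {z \<in> B. r \<in> nd z})})"
    by (rule even_sum_iff[OF finite_M])
  also have "{r \<in> M. odd (card {z \<in> B. r \<in> nd z})} = odd_nodes B N nd \<inter> M"
    using M_subset by (auto simp: odd_nodes_def)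
  also have "{z \<in> B. odd (card (nd z \<inter> M))} = {z \<in> B - {x, y}. u \<in> nd' z}"
  proof -
    have "odd (card (nd z \<inter> M)) \<longleftrightarrow> z \<noteq> x \<and> z \<noteq> y \<and> nd z \<inter> M \<noteq> {}" if "z \<in> B" for z
    proof (cases "z = x \<or> z = y")
      case True
      then have "nd z \<inter> M = nd z" by auto
      then show ?thesis using True card_nd that B by auto
    next
      case False
      moreover have "z \<in> V" using that B by blast
      ultimately show ?thesis using card_meets_path[of z] by simp
    qed
    then show ?thesis by (auto simp: mem_merge_image_iff)
  qed
  finally have u: "odd (card {z \<in> B - {x, y}. u \<in> nd' z}) \<longleftrightarrow> odd (card (odd_nodes B N nd \<inter> M))"
    by blast
  show ?thesis
  proof (rule set_eqI)
    fix r
    consider "r = u" | "r \<in> M" "r \<noteq> u" | "r \<notin> M" by blast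
    then show "r \<in> odd_nodes (B - {x, y}) N' nd' \<longleftrightarrow> r \<in> (odd_nodes B N nd - M) \<union>
      (if odd (card (odd_nodes B N nd \<inter> M)) then {u} else {})"
    proof cases
      case 1
      then show ?thesis using u M_subset ux by (auto simp: odd_nodes_def)
    next
      case 2
      then show ?thesis by (auto simp: odd_nodes_def)
    next
      case 3
      then show ?thesis using away[of r] ux by (auto simp: odd_nodes_def)
    qed
  qed
qed

text \<open>If 0, 1, 2 or 3 nodes of the path are odd, then 0, 1, 0 or 1 odd node results from
  merging them.\<close>

lemma card_odd_nodes_contract:
  assumes B: "B \<subseteq> V"
  shows "card (odd_nodes B N nd) \<le> card (odd_nodes (B - {x, y}) N' nd') + 2"
    and "card (odd_nodes B N nd \<inter> M) \<le> 1 \<Longrightarrow>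
      card (odd_nodes B N nd) \<le> card (odd_nodes (B - {x, y}) N' nd')"
proof -
  let ?O = "odd_nodes B N nd"
  have fin: "finite ?O" using finite_N by (simp add: odd_nodes_def)
  have O: "card ?O = card (?O - M) + card (?O \<inter> M)"
    using fin by (metis add.commute card_Int_Diff)
  have O': "card (odd_nodes (B - {x, y}) N' nd') =
    card (?O - M) + (if odd (card (?O \<inter> M)) then 1 else 0)"
    using ux fin by (simp add: odd_nodes_contract[OF B])
  have "card (?O \<inter> M) \<le> card M" using finite_M by (intro card_mono) auto
  then have "card (?O \<inter> M) \<le> 3" using card_M by simp
  then have "card (?O \<inter> M) = 0 \<or> card (?O \<inter> M) = 1 \<or> card (?O \<inter> M) = 2 \<or> card (?O \<inter> M) = 3"
    by linarith
  then show "card ?O \<le> card (odd_nodes (B - {x, y}) N' nd') + 2"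
    and "card (?O \<inter> M) \<le> 1 \<Longrightarrow> card ?O \<le> card (odd_nodes (B - {x, y}) N' nd')"
    unfolding O O' by auto
qed

lemma card_V': "card V' + 2 = card V"
proof -
  have "card {x, y} \<le> card V" using x y finite_V by (intro card_mono) auto
  then show ?thesis using x y xy finite_V by (simp add: card_Diff_subset)
qed

text \<open>For sparsity with \<open>u \<in> W\<close>, putting back \<open>x\<close>,
  \<open>y\<close> and the two lost nodes adds 2 to both sides. The merged node has odd degree
  because three odd parities are added.\<close>

lemma odd_tree_contract: "odd_tree V' N' nd'"
proof
  show "finite V'" using finite_V by simp
  show "nd' z \<subseteq> N'" if "z \<in> V'" for z
    using nd_subset[of z] that M_subset ux by (auto simp: merge_def)
  show "card (nd' z) = 2" if z: "z \<in> V'" for z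
  proof (cases "nd z \<inter> M = {}")
    case True
    then have "nd' z = id ` nd z" by (intro image_cong) (auto simp: merge_def)
    then show ?thesis using card_nd z by simp
  next
    case False
    then obtain s where s: "s \<in> nd z" "s \<in> M" by blast
    then obtain r where "nd z = {s, r}" "r \<notin> M" using meets_path[of z s] z by auto
    then have "nd' z = {u, r}" using s by (auto simp: merge_def)
    moreover have "u \<noteq> r" using \<open>r \<notin> M\<close> ux by blast
    ultimately show ?thesis by simp
  qed
  have "card (M - {u}) = 2" using card_M finite_M ux by simp
  moreover have "card N' = card N - card (M - {u})"
    using finite_M M_subset by (intro card_Diff_subset) auto
  ultimately show "card N' = Suc (card V')" using card_N card_V' by simp
  show "card {z \<in> V'. nd' z \<subseteq> W} < card W" if W: "W \<subseteq> N'" "W \<noteq> {}" for W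
  proof -
    have finW: "finite W" using W finite_N by (auto intro: finite_subset)
    show ?thesis
    proof (cases "u \<in> W")
      case False
      then have "{z \<in> V'. nd' z \<subseteq> W} \<subseteq> {z \<in> V. nd z \<subseteq> W}"
        by (auto simp: merge_def image_subset_iff split: if_splits)
      then have "card {z \<in> V'. nd' z \<subseteq> W} \<le> card {z \<in> V. nd z \<subseteq> W}"
        using finite_V by (intro card_mono) auto
      moreover have "W \<subseteq> N" using W by blast
      ultimately show ?thesis using sparse[of W] W by linarith
    next
      case True
      have "{z \<in> V'. nd' z \<subseteq> W} \<union> {x, y} \<subseteq> {z \<in> V. nd z \<subseteq> W \<union> M}"
        using x y by (auto simp: merge_def image_subset_iff split: if_splits)
      then have "card ({z \<in> V'. nd' z \<subseteq> W} \<union> {x, y}) \<le> card {z \<in> V. nd z \<subseteq> W \<union> M}"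
        using finite_V by (intro card_mono) auto
      also have "card ({z \<in> V'. nd' z \<subseteq> W} \<union> {x, y}) = card {z \<in> V'. nd' z \<subseteq> W} + 2"
        using finite_V xy by (subst card_Un_disjoint) auto
      also have "card {z \<in> V. nd z \<subseteq> W \<union> M} < card (W \<union> M)"
        using W M_subset by (intro sparse) auto
      also have "W \<union> M = W \<union> (M - {u})" using True by auto
      also have "card \<dots> = card W + card (M - {u})"
        using finW finite_M W by (intro card_Un_disjoint) auto
      finally show ?thesis using \<open>card (M - {u}) = 2\<close> by simp
    qed
  qed
  show "odd (card {z \<in> V'. r \<in> nd' z})" if r: "r \<in> N'" for r
  proof -
    have "odd_nodes V N nd = N" using odd_degree by (auto simp: odd_nodes_def)
    moreover have "N \<inter> M = M" using M_subset by blast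
    ultimately have "odd_nodes V' N' nd' = (N - M) \<union> {u}"
      using odd_nodes_contract[of V] card_M by simp
    then have "r \<in> odd_nodes V' N' nd'" using r by auto
    then show ?thesis by (simp add: odd_nodes_def)
  qed
qed

text \<open>Only \<open>x\<close> and \<open>y\<close> are deleted: an edge of the contracted tree
  has an adjacent edge unless it is the only one left, and then the exception for a master list with
  a single vertex protects it.\<close>

lemma gcds2_path: "gcds2 (line_graph V nd) {x, y} = line_graph V' nd'"
proof -
  interpret C: odd_tree V' N' nd' by (rule odd_tree_contract)
  let ?L = "master_list (line_graph V nd) {x, y}"
  have "\<not> (isolated (gcds (line_graph V nd) {x, y}) z \<and> ?L \<noteq> {z})" if z: "z \<in> ?L" for z
  proof (cases "card V' = 1")
    case True
    then obtain a where "V' = {a}" by (rule card_1_singletonE)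
    then have "?L \<subseteq> {a}" unfolding master_list_path by blast
    then have "?L = {z}" using z by blast
    then show ?thesis by simp
  next
    case False
    have zV: "z \<in> V'" using z by (simp add: master_list_path)
    then obtain q where q: "q \<in> V'" "q \<noteq> z" "nd' z \<inter> nd' q \<noteq> {}"
      using C.nd_disjoint_not_all[OF zV False] by blast
    then have "{z, q} \<in> edges (line_graph V' nd')" using zV by (simp only: edge_line_graph_iff) blast
    then have "q \<in> neighbors (gcds (line_graph V nd) {x, y}) z"
      using q unfolding neighbors_def edges_gcds_path[symmetric] by (simp add: gcds_def)
    then show ?thesis by (auto simp: isolated_def)
  qed
  then have "{z \<in> ?L. isolated (gcds (line_graph V nd) {x, y}) z \<and> ?L \<noteq> {z}} = {}" by blast
  then have "gcds2 (line_graph V nd) {x, y} = Graph V' (edges (line_graph V' nd'))"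
    by (simp only: gcds2_def edges_gcds_path verts_line_graph Diff_empty)
  then show ?thesis by (simp add: line_graph_def)
qed

end

context odd_tree
begin

text \<open>
  If there were no such path, then mapping each leaf outside \<open>Q\<close> to its neighbour (an inner node
  in \<open>Q\<close>) would inject the complement of \<open>Q\<close> into the inner nodes; but all inner nodes have degree
  at least 3, so they are less than half of all nodes.
\<close>

lemma exists_path_few:
  assumes V: "card V \<noteq> 1" and O: "Q \<subseteq> N" "2 * card Q \<le> card N"
  shows "\<exists>x\<in>V. \<exists>y\<in>V. x \<noteq> y \<and> nd x \<inter> nd y \<noteq> {} \<and> card (Q \<inter> (nd x \<union> nd y)) \<le> 1"
proof (rule ccontr)
  assume "\<not> ?thesis"
  then have many: "card (Q \<inter> (nd x \<union> nd y)) \<ge> 2"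
    if "x \<in> V" "y \<in> V" "x \<noteq> y" "nd x \<inter> nd y \<noteq> {}" for x y
    using that by fastforce
  \<comment> \<open>At least two of the three nodes of a path are in \<open>Q\<close>, hence at most
    one is outside.\<close>
  have two_out: False
    if "x \<in> V" "y \<in> V" "x \<noteq> y" "s \<in> nd x \<union> nd y" "s \<notin> Q" "r \<in> nd x \<union> nd y" "r \<notin> Q" "r \<noteq> s"
      "nd x \<inter> nd y \<noteq> {}"
    for x y r s
  proof -
    from that(9) obtain c where "c \<in> nd x" "c \<in> nd y" by blast
    then interpret odd_tree_path V N nd x y c using that by unfold_locales auto
    have "card (Q \<inter> (nd x \<union> nd y)) \<le> card ((nd x \<union> nd y) - {r, s})"
      using finite_M that by (intro card_mono) auto
    also have "\<dots> = 1" using card_M that finite_M by (subst card_Diff_subset) auto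
    finally show False using many[of x y] that by simp
  qed
  let ?deg = "\<lambda>r. card {z \<in> V. r \<in> nd z}"
  define I where "I = {r \<in> N. ?deg r \<noteq> 1}"
  have nb: "\<exists>r' z. z \<in> V \<and> nd z = {r, r'} \<and> r \<noteq> r' \<and> r' \<in> I \<and> r' \<in> Q"
    if r: "r \<in> N - Q" "r \<notin> I" for r
  proof -
    from r obtain z where z: "{z \<in> V. r \<in> nd z} = {z}"
      by (auto simp: I_def card_1_singleton_iff)
    then have zV: "z \<in> V" "r \<in> nd z" by auto
    obtain r' where r': "nd z = {r, r'}" "r \<noteq> r'"
      by (rule card_2_mem[OF card_nd[OF zV(1)] zV(2)])
    \<comment> \<open>As \<open>r\<close> is a leaf, an edge adjacent to \<open>z\<close> shares
      \<open>r'\<close> with it. So \<open>r'\<close> is inner, and it lies in \<open>Q\<close>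
      because \<open>r\<close> does not.\<close>
    obtain z' where z': "z' \<in> V" "z' \<noteq> z" "nd z \<inter> nd z' \<noteq> {}"
      using nd_disjoint_not_all[OF zV(1) V] by blast
    have "z' \<notin> {z \<in> V. r \<in> nd z}" unfolding z using z'(2) by simp
    then have "r' \<in> nd z'" using z'(1,3) r' by auto
    then have "{z, z'} \<subseteq> {z \<in> V. r' \<in> nd z}" using zV z'(1) r'(1) by simp
    then have "card {z, z'} \<le> ?deg r'" using finite_V by (intro card_mono) auto
    then have "r' \<in> I" using z' nd_subset[OF zV(1)] r' by (auto simp: I_def)
    moreover have "r' \<in> Q" using two_out[of z z' r r'] zV z' r' r by auto
    ultimately show ?thesis using r' zV by blast
  qed
  then have "\<forall>r \<in> N - Q - I. \<exists>r' z. z \<in> V \<and> nd z = {r, r'} \<and> r \<noteq> r' \<and> r' \<in> I \<and> r' \<in> Q"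
    by simp
  from bchoice[OF this] obtain \<psi> where \<psi>:
    "\<forall>r \<in> N - Q - I. \<exists>z. z \<in> V \<and> nd z = {r, \<psi> r} \<and> r \<noteq> \<psi> r \<and> \<psi> r \<in> I \<and> \<psi> r \<in> Q" ..
  \<comment> \<open>Inner nodes outside \<open>Q\<close> stay fixed while leaves move into
    \<open>Q\<close>, so their images differ; two leaves with the same neighbour would lie on a path
    with two nodes outside \<open>Q\<close>.\<close>
  define \<phi> where "\<phi> r = (if r \<in> I then r else \<psi> r)" for r
  have \<phi>: "\<exists>z. z \<in> V \<and> nd z = {r, \<phi> r} \<and> r \<noteq> \<phi> r \<and> \<phi> r \<in> I \<and> \<phi> r \<in> Q"
    if "r \<in> N - Q" "r \<notin> I" for r
    using \<psi> that by (simp add: \<phi>_def)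
  have "inj_on \<phi> (N - Q)"
  proof (rule inj_onI, rule ccontr)
    fix r s assume *: "r \<in> N - Q" "s \<in> N - Q" "\<phi> r = \<phi> s" "r \<noteq> s"
    have "\<phi> t = t \<and> t \<notin> Q" if "t \<in> N - Q" "t \<in> I" for t
      using that by (simp add: \<phi>_def)
    then have "r \<notin> I \<and> s \<notin> I"
      using * \<phi>[of r] \<phi>[of s] by metis
    then obtain z z' where "z \<in> V" "nd z = {r, \<phi> r}" "z' \<in> V" "nd z' = {s, \<phi> r}" "s \<noteq> \<phi> r"
      "r \<noteq> \<phi> r"
      using \<phi>[of r] \<phi>[of s] * by auto
    then show False using two_out[of z z' r s] * by (auto simp: doubleton_eq_iff)
  qed
  moreover have "\<phi> ` (N - Q) \<subseteq> I" using \<phi> \<phi>_def by fastforce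
  moreover have finI: "finite I" using finite_N by (simp add: I_def)
  ultimately have "card (N - Q) \<le> card I" by (rule card_inj_on_le)
  moreover have "card (N - Q) = card N - card Q"
    by (rule card_Diff_subset[OF finite_subset[OF O(1) finite_N] O(1)])
  ultimately have I: "card N \<le> 2 * card I" using O by linarith
  \<comment> \<open>With \<open>i = card I\<close>, the handshake will give
    \<open>2 * i + card N \<le> 2 * card V\<close>, that is
    \<open>2 * i + 2 \<le> card N\<close>.\<close>
  have "(\<Sum>r\<in>N. if r \<in> I then 3 else 1) \<le> (\<Sum>r\<in>N. ?deg r)"
  proof (rule sum_mono)
    fix r assume r: "r \<in> N"
    have "3 \<le> d" if "odd d" "d \<noteq> 1" for d :: nat
      using that by presburger
    then show "(if r \<in> I then 3 else 1) \<le> ?deg r"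
      using odd_degree[OF r] r by (auto simp: I_def)
  qed
  also have "\<dots> = 2 * card V" using handshake[of V] by simp
  also have "(\<Sum>r\<in>N. if r \<in> I then 3 else 1) = 3 * card (N \<inter> I) + card (N - I)"
    using finite_N by (simp add: sum.If_cases Diff_eq)
  also have "N \<inter> I = I" by (auto simp: I_def)
  also have "card (N - I) = card N - card I"
    using finI by (intro card_Diff_subset) (auto simp: I_def)
  finally show False using card_N I by linarith
qed

end

section \<open>The two players\<close>

text \<open>
  Both invariants describe the positions with \<open>4 * k + c\<close> vertices: for odd \<open>n\<close>, ONE is to move if
  \<open>c = 3\<close> and TWO if \<open>c = 1\<close>; for even \<open>n\<close> it is the other way round. The last vertex \<open>z\<close> comes
  with a tree consisting of the single edge \<open>z\<close>; it has two odd nodes if \<open>z \<in> B\<close>, and none otherwise.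
\<close>

definition ONE_invariant :: "'a set \<Rightarrow> nat \<Rightarrow> 'a graph \<Rightarrow> bool" where
  "ONE_invariant A c G \<longleftrightarrow> (\<exists>k V (N :: nat set) nd B.
     G = line_graph V nd \<and> odd_tree V N nd \<and> B \<subseteq> V \<inter> A \<and>
     card V = 4 * k + c \<and> 2 * k + 2 \<le> card (odd_nodes B N nd))"

lemma ONE_invariantI:
  fixes N :: "nat set"
  assumes "odd_tree V N nd" "B \<subseteq> V \<inter> A"
    "card V = 4 * k + c" "2 * k + 2 \<le> card (odd_nodes B N nd)"
  shows "ONE_invariant A c (line_graph V nd)"
  using assms unfolding ONE_invariant_def by blast

lemma ONE_invariantE:
  assumes "ONE_invariant A c G"
  obtains k V and N :: "nat set" and nd B where
    "G = line_graph V nd" "odd_tree V N nd" "B \<subseteq> V \<inter> A"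
    "card V = 4 * k + c" "2 * k + 2 \<le> card (odd_nodes B N nd)"
  using assms unfolding ONE_invariant_def by blast

lemma ONE_invariant_over:
  assumes "ONE_invariant A c G" "game_over G"
  shows "ONE_wins_at A G"
  using assms(1)
proof (rule ONE_invariantE)
  fix k V and N :: "nat set" and nd B
  assume G: "G = line_graph V nd" and "odd_tree V N nd" and B: "B \<subseteq> V \<inter> A"
    and card: "2 * k + 2 \<le> card (odd_nodes B N nd)"
  interpret odd_tree V N nd by fact
  have "card V = 1" using assms(2) G game_over_iff by simp
  then obtain z where "V = {z}" by (rule card_1_singletonE)
  moreover have "B \<noteq> {}" using card by (auto simp: odd_nodes_def)
  ultimately show "ONE_wins_at A G" using B by (auto simp: ONE_wins_at_def G)
qed

text \<open>Of the \<open>4 * k + 4\<close> nodes, \<open>2 * k + 2\<close> are exactly one half. At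
  this value ONE needs a path without loss; otherwise parity yields at least
  \<open>2 * k + 4\<close> odd nodes, and a loss of 2 is affordable.\<close>

lemma ONE_invariant_ONE_moves:
  assumes "ONE_invariant A 3 G"
  shows "\<exists>e\<in>edges G. ONE_invariant A 1 (gcds2 G e)"
  using assms
proof (rule ONE_invariantE)
  fix k V and N :: "nat set" and nd B
  assume G: "G = line_graph V nd" and "odd_tree V N nd" and B: "B \<subseteq> V \<inter> A"
    and V: "card V = 4 * k + 3" and O: "2 * k + 2 \<le> card (odd_nodes B N nd)"
  interpret odd_tree V N nd by fact
  have BV: "B \<subseteq> V" using B by blast
  \<comment> \<open>With \<open>Q = {}\<close> the existence lemma just provides some path, for the
    case where a loss is affordable.\<close>
  define Q where "Q = (if card (odd_nodes B N nd) = 2 * k + 2 then odd_nodes B N nd else {})"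
  have "Q \<subseteq> N" by (auto simp: Q_def odd_nodes_def)
  moreover have "2 * card Q \<le> card N" using card_N V by (simp add: Q_def)
  ultimately obtain x y where xy: "x \<in> V" "y \<in> V" "x \<noteq> y" "nd x \<inter> nd y \<noteq> {}"
    and few: "card (Q \<inter> (nd x \<union> nd y)) \<le> 1"
    using exists_path_few[of Q] V by auto
  from xy(4) obtain u where "u \<in> nd x" "u \<in> nd y" by blast
  then interpret P: odd_tree_path V N nd x y u using xy by unfold_locales auto
  have "2 * k + 2 \<le> card (odd_nodes (B - {x, y}) P.N' P.nd')"
  proof (cases "card (odd_nodes B N nd) = 2 * k + 2")
    case True
    then show ?thesis using P.card_odd_nodes_contract(2)[OF BV] few O by (simp add: Q_def)
  next
    case False
    moreover obtain j where "card (odd_nodes B N nd) = 2 * j"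
      using even_card_odd_nodes[OF BV] by (rule evenE)
    ultimately have "card (odd_nodes B N nd) = 2 * j" "j \<noteq> k + 1" "k + 1 \<le> j"
      using O by auto
    then have "2 * k + 4 \<le> card (odd_nodes B N nd)" by linarith
    then show ?thesis using P.card_odd_nodes_contract(1)[OF BV] by simp
  qed
  moreover have "card P.V' = 4 * k + 1" using P.card_V' V by simp
  moreover have "B - {x, y} \<subseteq> P.V' \<inter> A" using B by blast
  ultimately have "ONE_invariant A 1 (gcds2 G {x, y})"
    unfolding G P.gcds2_path using P.odd_tree_contract by (intro ONE_invariantI)
  moreover have "{x, y} \<in> edges G" using xy by (simp add: G)
  ultimately show ?thesis by blast
qed

text \<open>Passing from \<open>4 * k + 1\<close> to \<open>4 * (k - 1) + 3\<close> vertices lowers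
  the required count by 2, the most that a move can cost.\<close>

lemma ONE_invariant_TWO_moves:
  assumes "ONE_invariant A 1 G" "e \<in> edges G"
  shows "ONE_invariant A 3 (gcds2 G e)"
  using assms(1)
proof (rule ONE_invariantE)
  fix k V and N :: "nat set" and nd B
  assume G: "G = line_graph V nd" and "odd_tree V N nd" and B: "B \<subseteq> V \<inter> A"
    and V: "card V = 4 * k + 1" and O: "2 * k + 2 \<le> card (odd_nodes B N nd)"
  interpret odd_tree V N nd by fact
  obtain x y u where e: "e = {x, y}" and
    xy: "x \<in> V" "y \<in> V" "x \<noteq> y" "u \<in> nd x" "u \<in> nd y"
    using assms(2) unfolding G by (rule edge_line_graphE)
  interpret P: odd_tree_path V N nd x y u using xy by unfold_locales
  have "card P.V' + 2 = 4 * k + 1" using P.card_V' V by simp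
  then have "card P.V' = 4 * (k - 1) + 3" "2 * (k - 1) + 4 \<le> card (odd_nodes B N nd)"
    using O by (cases k; simp)+
  moreover have "B - {x, y} \<subseteq> P.V' \<inter> A" "B \<subseteq> V" using B by blast+
  moreover from calculation have "2 * (k - 1) + 2 \<le> card (odd_nodes (B - {x, y}) P.N' P.nd')"
    using P.card_odd_nodes_contract(1)[of B] by linarith
  ultimately show "ONE_invariant A 3 (gcds2 G e)"
    unfolding G e P.gcds2_path using P.odd_tree_contract by (intro ONE_invariantI)
qed

text \<open>The bound is void for \<open>k = 0\<close> and \<open>d = 0\<close>; the last conjunct
  is what denies ONE the win in a final position.\<close>

definition TWO_invariant :: "'a set \<Rightarrow> nat \<Rightarrow> nat \<Rightarrow> 'a graph \<Rightarrow> bool" where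
  "TWO_invariant A c d G \<longleftrightarrow> (\<exists>k V (N :: nat set) nd.
     G = line_graph V nd \<and> odd_tree V N nd \<and>
     card V = 4 * k + c \<and> 3 * k + d \<le> card (V - A) \<and> V - A \<noteq> {})"

lemma TWO_invariantI:
  fixes N :: "nat set"
  assumes "odd_tree V N nd" "card V = 4 * k + c" "3 * k + d \<le> card (V - A)" "V - A \<noteq> {}"
  shows "TWO_invariant A c d (line_graph V nd)"
  using assms unfolding TWO_invariant_def by blast

lemma TWO_invariantE:
  assumes "TWO_invariant A c d G"
  obtains k V and N :: "nat set" and nd where
    "G = line_graph V nd" "odd_tree V N nd"
    "card V = 4 * k + c" "3 * k + d \<le> card (V - A)" "V - A \<noteq> {}"
  using assms unfolding TWO_invariant_def by blast

lemma TWO_invariant_over: "TWO_invariant A c d G \<Longrightarrow> \<not> ONE_wins_at A G"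
  unfolding TWO_invariant_def ONE_wins_at_def by auto

lemma TWO_invariant_decreases:
  assumes "TWO_invariant A c d G" "e \<in> edges G"
  shows "card (verts (gcds2 G e)) < card (verts G)"
  using assms(1)
proof (rule TWO_invariantE)
  fix V and N :: "nat set" and nd
  assume G: "G = line_graph V nd" and "odd_tree V N nd"
  interpret odd_tree V N nd by fact
  obtain x y u where e: "e = {x, y}" and
    xy: "x \<in> V" "y \<in> V" "x \<noteq> y" "u \<in> nd x" "u \<in> nd y"
    using assms(2) unfolding G by (rule edge_line_graphE)
  interpret P: odd_tree_path V N nd x y u using xy by unfold_locales
  show "card (verts (gcds2 G e)) < card (verts G)"
    unfolding G e P.gcds2_path using P.card_V' by simp
qed

text \<open>ONE removes at most two vertices outside \<open>A\<close>, and
  \<open>3 * k - 2 = 3 * (k - 1) + 1\<close>.\<close>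

lemma TWO_invariant_ONE_moves:
  assumes "TWO_invariant A 1 0 G" "e \<in> edges G"
  shows "TWO_invariant A 3 1 (gcds2 G e)"
  using assms(1)
proof (rule TWO_invariantE)
  fix k V and N :: "nat set" and nd
  assume G: "G = line_graph V nd" and "odd_tree V N nd"
    and V: "card V = 4 * k + 1" and bad: "3 * k + 0 \<le> card (V - A)"
  interpret odd_tree V N nd by fact
  obtain x y u where e: "e = {x, y}" and
    xy: "x \<in> V" "y \<in> V" "x \<noteq> y" "u \<in> nd x" "u \<in> nd y"
    using assms(2) unfolding G by (rule edge_line_graphE)
  interpret P: odd_tree_path V N nd x y u using xy by unfold_locales
  have "card P.V' + 2 = 4 * k + 1" using P.card_V' V by simp
  then have V': "card P.V' = 4 * (k - 1) + 3" and k: "k \<ge> 1"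
    by (cases k; simp)+
  have "V - A \<subseteq> (P.V' - A) \<union> {x, y}" by blast
  then have "card (V - A) \<le> card ((P.V' - A) \<union> {x, y})"
    using finite_V by (intro card_mono) auto
  also have "\<dots> \<le> card (P.V' - A) + card {x, y}" by (rule card_Un_le)
  also have "card {x, y} = 2" using xy by simp
  finally have bad': "3 * (k - 1) + 1 \<le> card (P.V' - A)" using bad k by linarith
  then have "P.V' - A \<noteq> {}" by (metis add_is_0 card.empty le_zero_eq one_neq_zero)
  then show "TWO_invariant A 3 1 (gcds2 G e)"
    unfolding G e P.gcds2_path using P.odd_tree_contract V' bad' by (intro TWO_invariantI)
qed

text \<open>An edge with an end in \<open>A\<close> costs at most one vertex outside
  \<open>A\<close>, as the counts allow. If no vertex of \<open>A\<close> is left, there is slack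
  for \<open>k > 0\<close>; for \<open>k = 0\<close> it is enough that some vertex outside
  \<open>A\<close> survives.\<close>

lemma TWO_invariant_TWO_moves:
  assumes "TWO_invariant A 3 1 G"
  shows "\<exists>e\<in>edges G. TWO_invariant A 1 0 (gcds2 G e)"
  using assms
proof (rule TWO_invariantE)
  fix k V and N :: "nat set" and nd
  assume G: "G = line_graph V nd" and "odd_tree V N nd"
    and V: "card V = 4 * k + 3" and bad: "3 * k + 1 \<le> card (V - A)" "V - A \<noteq> {}"
  interpret odd_tree V N nd by fact
  have V1: "card V \<noteq> 1" using V by simp
  have "\<exists>x\<in>V. \<exists>y\<in>V. x \<noteq> y \<and> nd x \<inter> nd y \<noteq> {} \<and>
    3 * k \<le> card (V - {x, y} - A) \<and> V - {x, y} - A \<noteq> {}"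
  proof (cases "k = 0")
    case True
    obtain v where v: "v \<in> V" "v \<notin> A" using bad(2) by blast
    \<comment> \<open>There are four nodes, so the two ends of \<open>v\<close> may serve as
      \<open>Q\<close>; a path with at most one of them cannot contain the edge
      \<open>v\<close>.\<close>
    have "2 * card (nd v) \<le> card N" using card_nd[OF v(1)] card_N V by simp
    then obtain x y where xy: "x \<in> V" "y \<in> V" "x \<noteq> y" "nd x \<inter> nd y \<noteq> {}"
      and few: "card (nd v \<inter> (nd x \<union> nd y)) \<le> 1"
      using exists_path_few[OF V1 nd_subset[OF v(1)]] by blast
    have "v \<noteq> x" "v \<noteq> y"
      using few card_nd[OF v(1)] by (auto simp: Int_absorb2 Int_absorb1)
    then have "v \<in> V - {x, y} - A" using v by blast
    then show ?thesis using True xy by auto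
  next
    case False
    show ?thesis
    proof (cases "V \<inter> A = {}")
      case True
      obtain x y where xy: "x \<in> V" "y \<in> V" "x \<noteq> y" "nd x \<inter> nd y \<noteq> {}"
        using exists_path_few[OF V1, of "{}"] by auto
      have "card (V - {x, y}) = card V - 2"
        using xy finite_V by (simp add: card_Diff_subset)
      moreover have "V - {x, y} - A = V - {x, y}" using True by blast
      ultimately have "card (V - {x, y} - A) = 4 * k + 1" using V by simp
      moreover from this have "V - {x, y} - A \<noteq> {}"
        by (metis add_is_0 card.empty one_neq_zero)
      ultimately have "3 * k \<le> card (V - {x, y} - A)" "V - {x, y} - A \<noteq> {}" by simp_all
      then show ?thesis using xy by blast
    next
      case nonempty: False
      then obtain x where x: "x \<in> V" "x \<in> A" by blast
      then obtain y where y: "y \<in> V" "y \<noteq> x" "nd x \<inter> nd y \<noteq> {}"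
        using nd_disjoint_not_all[OF x(1) V1] by blast
      have "V - A \<subseteq> insert y (V - {x, y} - A)" using x by blast
      then have "card (V - A) \<le> card (insert y (V - {x, y} - A))"
        using finite_V by (intro card_mono) auto
      also have "\<dots> \<le> Suc (card (V - {x, y} - A))"
        using finite_V by (simp add: card_insert_if)
      finally have *: "3 * k \<le> card (V - {x, y} - A)" using bad(1) by simp
      then have "card (V - {x, y} - A) \<noteq> 0" using \<open>k \<noteq> 0\<close> by linarith
      then have "V - {x, y} - A \<noteq> {}" by (metis card.empty)
      with * show ?thesis using x(1) y(1,3) y(2)[symmetric]
        by (intro bexI[of _ x] bexI[of _ y] conjI)
    qed
  qed
  then obtain x y where xy: "x \<in> V" "y \<in> V" "x \<noteq> y" "nd x \<inter> nd y \<noteq> {}"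
    and bad': "3 * k \<le> card (V - {x, y} - A)" "V - {x, y} - A \<noteq> {}" by blast
  from xy(4) obtain u where "u \<in> nd x" "u \<in> nd y" by blast
  then interpret P: odd_tree_path V N nd x y u using xy by unfold_locales auto
  have "card P.V' = 4 * k + 1" "3 * k + 0 \<le> card (P.V' - A)" using P.card_V' V bad' by simp_all
  then have "TWO_invariant A 1 0 (gcds2 G {x, y})"
    unfolding G P.gcds2_path using P.odd_tree_contract bad'(2) by (intro TWO_invariantI)
  moreover have "{x, y} \<in> edges G" using xy by (simp add: G)
  ultimately show ?thesis by blast
qed

section \<open>The chain of triangles\<close>

text \<open>
  The triangles are the nodes \<open>2, 4, \<dots>, 2 * n\<close> of a path from \<open>0\<close> to \<open>2 * n + 2\<close> formed by the odd
  vertices; the even vertex \<open>2 * i\<close> is a pendant edge at the node \<open>2 * i\<close>, ending in the leaf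
  \<open>2 * i + 1\<close>.
\<close>

definition tri_ends :: "nat \<Rightarrow> nat set" where
  "tri_ends z = (if odd z then {z - 1, z + 1} else {z, z + 1})"

lemma mem_tri_ends_iff:
  "z \<ge> 1 \<Longrightarrow> r \<in> tri_ends z \<longleftrightarrow> (if odd z then z = r + 1 \<or> r = z + 1 else r = z \<or> r = z + 1)"
  by (auto simp: tri_ends_def)

lemma verts_tri_graph: "verts (tri_graph (Suc m)) = {1..2 * m + 3}"
proof (induction m)
  case 0
  then show ?case by auto
next
  case (Suc m)
  then show ?case by (auto simp: Let_def)
qed

lemma edges_line_graph_insert:
  assumes "v \<notin> V"
  shows "edges (line_graph (insert v V) nd) =
    edges (line_graph V nd) \<union> (\<lambda>w. {w, v}) ` {w \<in> V. nd w \<inter> nd v \<noteq> {}}"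
proof -
  let ?E = "edges (line_graph V nd) \<union> (\<lambda>w. {w, v}) ` {w \<in> V. nd w \<inter> nd v \<noteq> {}}"
  have "e \<in> ?E" if "e \<in> edges (line_graph (insert v V) nd)" for e
    using that
  proof (rule edge_line_graphE)
    fix x y u
    assume e: "e = {x, y}" "x \<in> insert v V" "y \<in> insert v V" "x \<noteq> y"
      and "u \<in> nd x" "u \<in> nd y"
    then have meet: "nd x \<inter> nd y \<noteq> {}" "nd y \<inter> nd x \<noteq> {}" by blast+
    consider "x = v" "y \<in> V" | "y = v" "x \<in> V" | "x \<in> V" "y \<in> V" using e by blast
    then show ?thesis
    proof cases
      case 1
      then show ?thesis using e(1) meet(2) by (simp add: insert_commute image_iff) blast
    next
      case 2
      then show ?thesis using e(1) meet(1) by (simp add: image_iff) blast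
    next
      case 3
      then show ?thesis using e(1,4) meet(1) by simp
    qed
  qed
  moreover have "e \<in> edges (line_graph (insert v V) nd)" if "e \<in> ?E" for e
    using that
  proof
    assume "e \<in> edges (line_graph V nd)"
    then show ?thesis by (rule edge_line_graphE) auto
  next
    assume "e \<in> (\<lambda>w. {w, v}) ` {w \<in> V. nd w \<inter> nd v \<noteq> {}}"
    then obtain w where "e = {w, v}" "w \<in> V" "nd w \<inter> nd v \<noteq> {}" by blast
    then show ?thesis using assms by auto
  qed
  ultimately show ?thesis by (intro equalityI subsetI)
qed

text \<open>The new edges \<open>2 * m + 2\<close> and \<open>2 * m + 3\<close> share the node
  \<open>2 * m + 2\<close>, where \<open>2 * m + 1\<close> is the only earlier edge to end; their
  other ends are new.\<close>

lemma edges_line_graph_tri_ends: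
  "edges (line_graph {1..2 * m + 3} tri_ends) = edges (line_graph {1..2 * m + 1} tri_ends) \<union>
     {{2 * m + 1, 2 * m + 2}, {2 * m + 1, 2 * m + 3}, {2 * m + 2, 2 * m + 3}}"
proof -
  let ?V = "{1..2 * m + 1}" and ?a = "2 * m + 2" and ?b = "2 * m + 3"
  have V: "{1..2 * m + 3} = insert ?b (insert ?a ?V)" by auto
  have ends: "tri_ends ?a = {2 * m + 2, 2 * m + 3}" "tri_ends ?b = {2 * m + 2, 2 * m + 4}"
    by (auto simp: tri_ends_def)
  have "w \<in> ?V \<and> (2 * m + 2 \<in> tri_ends w \<or> 2 * m + 3 \<in> tri_ends w) \<longleftrightarrow> w = 2 * m + 1" for w
    by (cases "w \<ge> 1"; simp add: mem_tri_ends_iff; presburger)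
  then have a: "{w \<in> ?V. tri_ends w \<inter> tri_ends ?a \<noteq> {}} = {2 * m + 1}"
    unfolding ends by auto
  have "w \<in> insert ?a ?V \<and> (2 * m + 2 \<in> tri_ends w \<or> 2 * m + 4 \<in> tri_ends w) \<longleftrightarrow>
    w = 2 * m + 1 \<or> w = ?a" for w
    by (cases "w \<ge> 1"; simp add: mem_tri_ends_iff; presburger)
  then have b: "{w \<in> insert ?a ?V. tri_ends w \<inter> tri_ends ?b \<noteq> {}} = {2 * m + 1, ?a}"
    unfolding ends by auto
  have "edges (line_graph (insert ?a ?V) tri_ends) =
    edges (line_graph ?V tri_ends) \<union> (\<lambda>w. {w, ?a}) ` {2 * m + 1}"
    unfolding a[symmetric] by (rule edges_line_graph_insert) simp
  moreover have "edges (line_graph (insert ?b (insert ?a ?V)) tri_ends) =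
    edges (line_graph (insert ?a ?V) tri_ends) \<union> (\<lambda>w. {w, ?b}) ` {2 * m + 1, ?a}"
    unfolding b[symmetric] by (rule edges_line_graph_insert) simp
  ultimately have "edges (line_graph {1..2 * m + 3} tri_ends) = edges (line_graph ?V tri_ends) \<union>
    (\<lambda>w. {w, ?a}) ` {2 * m + 1} \<union> (\<lambda>w. {w, ?b}) ` {2 * m + 1, ?a}"
    unfolding V by simp
  then show ?thesis by auto
qed

lemma edges_tri_graph: "edges (tri_graph (Suc m)) = edges (line_graph {1..2 * m + 3} tri_ends)"
proof (induction m)
  case 0
  have "edges (line_graph {1..2 * 0 + 1 :: nat} tri_ends) = {}"
    by (auto simp: line_graph_def)
  then show ?case by (subst edges_line_graph_tri_ends) (simp add: numeral_2_eq_2)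
next
  case (Suc m)
  let ?T = "{{2 * Suc m + 1, 2 * Suc m + 2}, {2 * Suc m + 1, 2 * Suc m + 3},
    {2 * Suc m + 2, 2 * Suc m + 3}}"
  have "edges (tri_graph (Suc (Suc m))) = edges (tri_graph (Suc m)) \<union> ?T"
    by (simp only: tri_graph.simps Let_def graph.sel)
  also have "edges (tri_graph (Suc m)) = edges (line_graph {1..2 * Suc m + 1} tri_ends)"
    unfolding Suc.IH by (intro arg_cong[where f = "\<lambda>k. edges (line_graph {1..k} tri_ends)"]) simp
  also have "\<dots> \<union> ?T = edges (line_graph {1..2 * Suc m + 3} tri_ends)"
    by (rule edges_line_graph_tri_ends[symmetric])
  finally show ?case .
qed

lemma tri_graph_eq: "n \<ge> 1 \<Longrightarrow> tri_graph n = line_graph {1..2 * n + 1} tri_ends"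
proof -
  assume "n \<ge> 1"
  then obtain m where n: "n = Suc m" by (cases n) auto
  have "2 * Suc m + 1 = 2 * m + 3" by simp
  then show ?thesis
    unfolding n by (intro graph.expand) (simp only: edges_tri_graph verts_tri_graph verts_line_graph)
qed

text \<open>Node 1 is left out because no edge ends there. For sparsity, each edge \<open>z\<close>
  is charged to its upper end \<open>Suc z\<close>, which is never the least node of
  \<open>W\<close>. The degrees are 1 at odd-numbered nodes and at both ends of the path, and 3
  elsewhere.\<close>

lemma odd_tree_tri_graph: "odd_tree {1..2 * n + 1} ({..2 * n + 2} - {1}) tri_ends"
proof
  let ?V = "{1..2 * n + 1}" and ?N = "{..2 * n + 2} - {1 :: nat}"
  show "finite ?V" by simp
  show "tri_ends z \<subseteq> ?N" if "z \<in> ?V" for z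
    using that by (auto simp: tri_ends_def elim!: oddE)
  show "card (tri_ends z) = 2" for z
    by (auto simp: tri_ends_def card_insert_if)
  show "card ?N = Suc (card ?V)" by simp
  show "card {z \<in> ?V. tri_ends z \<subseteq> W} < card W" if W: "W \<subseteq> ?N" "W \<noteq> {}" for W
  proof -
    have finW: "finite W" using W(1) by (rule finite_subset) simp
    have "Suc z \<in> W - {Min W}" if z: "tri_ends z \<subseteq> W" "1 \<le> z" for z
    proof -
      have "Suc z \<in> W" "z \<in> W \<or> z - 1 \<in> W"
        using z by (auto simp: tri_ends_def split: if_splits)
      then have "Min W \<le> z" using Min_le[OF finW, of z] Min_le[OF finW, of "z - 1"] by auto
      then show ?thesis using \<open>Suc z \<in> W\<close> by auto
    qed
    then have "Suc ` {z \<in> ?V. tri_ends z \<subseteq> W} \<subseteq> W - {Min W}" by auto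
    then have "card (Suc ` {z \<in> ?V. tri_ends z \<subseteq> W}) \<le> card (W - {Min W})"
      using finW by (intro card_mono) auto
    also have "\<dots> < card W"
      by (rule card_Diff1_less[OF finW Min_in[OF finW W(2)]])
    finally show ?thesis by (simp add: card_image)
  qed
  show "odd (card {z \<in> ?V. r \<in> tri_ends z})" if r: "r \<in> ?N" for r
  proof -
    have *: "z \<in> {z \<in> ?V. r \<in> tri_ends z} \<longleftrightarrow> 1 \<le> z \<and> z \<le> 2 * n + 1 \<and>
      (if odd z then z = r + 1 \<or> r = z + 1 else r = z \<or> r = z + 1)" for z
      using mem_tri_ends_iff[of z r] by auto
    have r': "r \<le> 2 * n + 2" "r \<noteq> 1" using r by auto
    consider "odd r" | "r = 0" | "r = 2 * n + 2" | "even r" "0 < r" "r < 2 * n + 2"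
      using r' by linarith
    then show ?thesis
    proof cases
      case 1
      then have "{z \<in> ?V. r \<in> tri_ends z} = {r - 1}"
        using r' by (intro set_eqI) (unfold * singleton_iff, presburger)
      then show ?thesis by simp
    next
      case 2
      then have "{z \<in> ?V. r \<in> tri_ends z} = {1}"
        by (intro set_eqI) (unfold * singleton_iff, presburger)
      then show ?thesis by simp
    next
      case 3
      then have "{z \<in> ?V. r \<in> tri_ends z} = {2 * n + 1}"
        by (intro set_eqI) (unfold * singleton_iff, presburger)
      then show ?thesis by simp
    next
      case 4
      then have "{z \<in> ?V. r \<in> tri_ends z} = {r - 1, r, r + 1}"
        by (intro set_eqI) (unfold * insert_iff empty_iff, presburger)
      moreover have "card {r - 1, r, r + 1} = 3" using 4 by (cases r) simp_all
      ultimately show ?thesis by simp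
    qed
  qed
qed

section \<open>The set \<open>A_set n\<close> and its odd nodes\<close>

lemma A_set_eq: "n \<ge> 1 \<Longrightarrow> A_set n = insert 2 ((*) 4 ` {1..n div 2})"
proof -
  assume n: "n \<ge> 1"
  have "{k \<in> {1..2 * n + 1}. k mod 4 = 0} = (*) 4 ` {1..n div 2}"
    by (auto simp: image_iff dvd_def mod_eq_0_iff_dvd)
  then show ?thesis using n by (simp add: A_set_def tri_graph_eq)
qed

lemma card_A_set: "n \<ge> 1 \<Longrightarrow> card (A_set n) = Suc (n div 2)"
proof -
  have "2 \<notin> (*) (4 :: nat) ` {1..n div 2}" by auto
  moreover have "card ((*) (4 :: nat) ` {1..n div 2}) = n div 2" by (subst card_image) (auto intro: inj_onI)
  ultimately show "n \<ge> 1 \<Longrightarrow> ?thesis" by (simp add: A_set_eq)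
qed

lemma A_set_subset: "n \<ge> 1 \<Longrightarrow> A_set n \<subseteq> {1..2 * n + 1}"
  by (auto simp: A_set_eq)

lemma even_A_set: "n \<ge> 1 \<Longrightarrow> z \<in> A_set n \<Longrightarrow> even z"
  by (auto simp: A_set_eq)

text \<open>The elements of \<open>A_set n\<close> are even, hence pairwise disjoint pendant edges,
  and the odd nodes are exactly their ends.\<close>

lemma card_odd_nodes_A_set:
  assumes "n \<ge> 1"
  shows "card (odd_nodes (A_set n) ({..2 * n + 2} - {1}) tri_ends) = 2 * Suc (n div 2)"
proof -
  let ?A = "A_set n"
  have ends: "tri_ends z = {z, Suc z}" if "z \<in> ?A" for z
    using even_A_set[OF assms that] by (simp add: tri_ends_def)
  \<comment> \<open>Rounding \<open>r\<close> down to an even number gives the only pendant edge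
    that can end at \<open>r\<close>.\<close>
  have "r \<in> tri_ends z \<longleftrightarrow> z = r - r mod 2" if "z \<in> ?A" for z r
  proof -
    have "r = z \<or> r = Suc z \<longleftrightarrow> z = r - r mod 2"
      using even_A_set[OF assms that] by presburger
    then show ?thesis using ends[OF that] by simp
  qed
  then have "{z \<in> ?A. r \<in> tri_ends z} = ?A \<inter> {r - r mod 2}" for r by blast
  then have odd: "odd (card {z \<in> ?A. r \<in> tri_ends z}) \<longleftrightarrow> r - r mod 2 \<in> ?A" for r
    by (cases "r - r mod 2 \<in> ?A") simp_all
  have "r \<in> ?A \<union> Suc ` ?A \<longleftrightarrow> r \<in> {..2 * n + 2} - {1} \<and> r - r mod 2 \<in> ?A" for r
  proof -
    have "r - r mod 2 \<in> ?A \<longleftrightarrow> r \<in> ?A \<or> r \<in> Suc ` ?A"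
    proof (cases "even r")
      case True
      then show ?thesis using even_A_set[OF assms] by fastforce
    next
      case False
      then have "r \<notin> ?A" "r = Suc (r - 1)" "r - r mod 2 = r - 1"
        using even_A_set[OF assms] by (auto simp: odd_iff_mod_2_eq_one)
      then show ?thesis by (metis imageE image_eqI diff_Suc_1)
    qed
    moreover have "1 \<le> r - r mod 2 \<and> r - r mod 2 \<le> 2 * n + 1" if "r - r mod 2 \<in> ?A"
      using A_set_subset[OF assms] that by auto
    then have "r \<in> {..2 * n + 2} - {1}" if "r - r mod 2 \<in> ?A"
      using that by auto
    ultimately show ?thesis by blast
  qed
  then have "odd_nodes ?A ({..2 * n + 2} - {1}) tri_ends = ?A \<union> Suc ` ?A"
    unfolding odd_nodes_def odd by blast
  moreover have "finite ?A" by (rule finite_subset[OF A_set_subset[OF assms]]) simp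
  moreover have "Suc z \<notin> ?A" if "z \<in> ?A" for z
    using even_A_set[OF assms that] even_A_set[OF assms, of "Suc z"] by auto
  then have "?A \<inter> Suc ` ?A = {}" by blast
  ultimately show ?thesis
    using card_A_set[OF assms] by (simp add: card_Un_disjoint card_image)
qed

theorem corollary6:
  fixes n :: nat
  assumes "n \<ge> 1"
  shows "(\<exists>\<sigma>. winning_strategy_ONE (tri_graph n) (A_set n) \<sigma>) \<longleftrightarrow> odd n"
proof -
  let ?V = "{1..2 * n + 1}"
  note tree = odd_tree_tri_graph[of n] and sub = A_set_subset[OF assms]
  show ?thesis
  proof (cases "odd n")
    case True
    \<comment> \<open>With \<open>k = n div 2\<close>, the initial \<open>2 * Suc k\<close> odd
      nodes meet the bound of the invariant with equality.\<close>
    then have "card ?V = 4 * (n div 2) + 3" by simp presburger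
    then have init: "ONE_invariant (A_set n) 3 (tri_graph n)"
      unfolding tri_graph_eq[OF assms]
      using sub card_odd_nodes_A_set[OF assms]
      by (intro ONE_invariantI[OF tree, where B = "A_set n"]) auto
    have "\<exists>\<sigma>. winning_strategy_ONE (tri_graph n) (A_set n) \<sigma>"
    proof (rule ONE_wins_by_invariant[where P = "ONE_invariant (A_set n) 3"
        and Q = "ONE_invariant (A_set n) 1"])
      show "ONE_wins_at (A_set n) G"
        if "ONE_invariant (A_set n) 3 G \<or> ONE_invariant (A_set n) 1 G" "game_over G" for G
        using that ONE_invariant_over by blast
    qed (blast intro: init ONE_invariant_ONE_moves ONE_invariant_TWO_moves)+
    then show ?thesis using True by simp
  next
    case False
    then have V: "card ?V = 4 * (n div 2) + 1" by simp
    have "card (?V - A_set n) = card ?V - card (A_set n)"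
      by (rule card_Diff_subset[OF finite_subset[OF sub] sub]) simp
    \<comment> \<open>With \<open>k = n div 2\<close>, this is \<open>(4 * k + 1) - (k + 1)\<close>,
      again equality in the bound.\<close>
    then have bad: "card (?V - A_set n) = 3 * (n div 2)"
      using V card_A_set[OF assms] by simp
    have "n div 2 \<noteq> 0" using assms False by presburger
    then have "?V - A_set n \<noteq> {}" using bad by (metis card.empty mult_eq_0_iff zero_neq_numeral)
    then have init: "TWO_invariant (A_set n) 1 0 (tri_graph n)"
      unfolding tri_graph_eq[OF assms]
      using V bad by (intro TWO_invariantI[OF tree, where k = "n div 2"]) auto
    have "\<not> winning_strategy_ONE (tri_graph n) (A_set n) \<sigma>" for \<sigma>
    proof (rule TWO_wins_by_invariant[where P = "TWO_invariant (A_set n) 1 0"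
        and Q = "TWO_invariant (A_set n) 3 1"])
      fix G assume inv: "TWO_invariant (A_set n) 1 0 G \<or> TWO_invariant (A_set n) 3 1 G"
      show "\<not> ONE_wins_at (A_set n) G" using inv TWO_invariant_over by blast
      show "card (verts (gcds2 G e)) < card (verts G)" if "e \<in> edges G" for e
        using inv TWO_invariant_decreases that by blast
    qed (blast intro: init TWO_invariant_ONE_moves TWO_invariant_TWO_moves)+
    then show ?thesis using False by simp
  qed
qed

end
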